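(* Suppose that for all $a,a'\in\Delta(\mathcal B)$, $\phi(a,t)-\phi(a',t)$ is single-crossing in $t$. Then a set of bundles $\{b_1,\dots,b_m\}\subseteq\mathcal B$ is a minimal optimal menu for the upper-envelope problem if and only if both of the following hold: 1. any very weakly dominated bundle, and in particular any $b\in\mathcal B\setminus\{b_1,\dots,b_m\}$, is very weakly dominated by a convex combination of $b_1,\dots,b_m$; 2. for every $i\in\{1,\dots,m\}$, $b_i$ is not very weakly dominated. In addition, the minimal optimal menu for the upper-envelope problem is unique.
   Context: Setup. There are $n\ge 1$ goods; $\mathcal B=2^{\{1,\dots,n\}}$ is the set of (deterministic) bundles and $\Delta(\mathcal B)$ is the set of probability distributions on $\mathcal B$ (stochastic bundles); a bundle $b$ is identified with the point mass at $b$. The word "bundle" without qualification means an element of $\mathcal B$. Types $t$ lie in $T=[\underline t,\bar t]\subseteq\mathbb R$, $\underline t<\bar t$, and are distributed according to $F$ with a continuous, positive density $f$. The value function $v:\Delta(\mathcal B)\times T\to\mathbb R$ is continuously differentiable in $t$, with $v(\emptyset,t)=0$ for all $t$ and $v(a,t)=\mathbb E_{b\sim a}[v(b,t)]$. The virtual value function is $\phi(b,t)=v(b,t)-\frac{1-F(t)}{f(t)}v_t(b,t)$, $v_t=\partial v/\partial t$, extended by $\phi(a,t)=\mathbb E_{b\sim a}[\phi(b,t)]$ for $a\in\Delta(\mathcal B)$. Standing assumptions: for $b\ne b'$ in $\mathcal B$ there is $t\in T$ with $\phi(b,t)\neq\phi(b',t)$; and $\max_{b\neq\emptyset}\phi(b,\underline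 t)<0=\phi(\emptyset,\underline t)$. Terminology. A function $g:T\to\mathbb R$ is single-crossing in $t$ if $\operatorname{sign}[g(t)]\in\{-1,0,1\}$ is a monotonic function of $t$ (either weakly increasing or weakly decreasing). A stochastic bundle $a\in\Delta(\mathcal B)$ is very weakly dominated by $a'\in\Delta(\mathcal B)$ if $a'\ne a$ and $\phi(a,t)\le\phi(a',t)$ for all $t\in T$; it is very weakly dominated if it is very weakly dominated by some $a'\in\Delta(\mathcal B)$. A convex combination of $b_1,\dots,b_m$ is an element of $\Delta(\mathcal B)$ supported in $\{b_1,\dots,b_m\}$. Upper-envelope problem. This is the unconstrained problem with value $\mathbb E[\max_{b\in\mathcal B}\phi(b,t)]$. A menu $B\subseteq\mathcal B$ is optimal for it if for every $t\in T$ some element of $\operatorname{argmax}_{b\in\mathcal B}\phi(b,t)$ belongs to $B$; it is a minimal optimal menu if moreover no $B'\subsetneq B$ is optimal for it. *)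

theory Defs
  imports "HOL-Probability.Probability"
begin

definition bundles :: "nat \<Rightarrow> nat set set" where
  "bundles n = Pow {1..n}"

definition stochastic_bundles :: "nat \<Rightarrow> nat set pmf set" where
  "stochastic_bundles n = {a. set_pmf a \<subseteq> bundles n}"

text \<open>Types are distributed on \<open>T\<close> according to the measure \<open>F\<close> with density \<open>f\<close>. The value
  function is only given on \<open>T\<close>, so the derivative in the type is taken within \<open>T\<close>
  (one-sided at the end points).\<close>

definition virtual_value ::
  "real set \<Rightarrow> real measure \<Rightarrow> (real \<Rightarrow> real) \<Rightarrow> (nat set pmf \<Rightarrow> real \<Rightarrow> real)
    \<Rightarrow> nat set pmf \<Rightarrow> real \<Rightarrow> real" where
  "virtual_value T F f v a t = measure_pmf.expectation a (\<lambda>b.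
     v (return_pmf b) t
       - (1 - cdf F t) / f t * vector_derivative (v (return_pmf b)) (at t within T))"

definition single_crossing_on :: "real set \<Rightarrow> (real \<Rightarrow> real) \<Rightarrow> bool" where
  "single_crossing_on T g \<longleftrightarrow> mono_on T (\<lambda>t. sgn (g t)) \<or> antimono_on T (\<lambda>t. sgn (g t))"

definition very_weakly_dominated_by ::
  "real set \<Rightarrow> (nat set pmf \<Rightarrow> real \<Rightarrow> real) \<Rightarrow> nat set pmf \<Rightarrow> nat set pmf \<Rightarrow> bool" where
  "very_weakly_dominated_by T \<phi> a a' \<longleftrightarrow> a' \<noteq> a \<and> (\<forall>t\<in>T. \<phi> a t \<le> \<phi> a' t)"

definition very_weakly_dominated ::
  "nat \<Rightarrow> real set \<Rightarrow> (nat set pmf \<Rightarrow> real \<Rightarrow> real) \<Rightarrow> nat set pmf \<Rightarrow> bool" where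
  "very_weakly_dominated n T \<phi> a \<longleftrightarrow>
     (\<exists>a'\<in>stochastic_bundles n. very_weakly_dominated_by T \<phi> a a')"

definition convex_combinations :: "nat set set \<Rightarrow> nat set pmf set" where
  "convex_combinations M = {a. set_pmf a \<subseteq> M}"

definition optimal_menu ::
  "nat \<Rightarrow> real set \<Rightarrow> (nat set pmf \<Rightarrow> real \<Rightarrow> real) \<Rightarrow> nat set set \<Rightarrow> bool" where
  "optimal_menu n T \<phi> M \<longleftrightarrow> M \<subseteq> bundles n \<and>
     (\<forall>t\<in>T. \<exists>b\<in>M. is_arg_max (\<lambda>b. \<phi> (return_pmf b) t) (\<lambda>b. b \<in> bundles n) b)"

definition minimal_optimal_menu ::
  "nat \<Rightarrow> real set \<Rightarrow> (nat set pmf \<Rightarrow> real \<Rightarrow> real) \<Rightarrow> nat set set \<Rightarrow> bool" where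
  "minimal_optimal_menu n T \<phi> M \<longleftrightarrow>
     optimal_menu n T \<phi> M \<and> (\<forall>M'. M' \<subset> M \<longrightarrow> \<not> optimal_menu n T \<phi> M')"

end

theory Submission
  imports Defs
begin

text \<open>The heart of the matter is that if an optimal menu \<open>M\<close> omits \<open>b\<close>, then some mixture of at most
  two elements of \<open>M\<close> dominates \<open>b\<close>. The differences \<open>h m = \<phi> m - \<phi> b\<close> are single-crossing and at
  every type one of them is nonnegative. Hence the types are covered by two closed sets: those where
  some \<open>h m\<close> that is nonnegative at the lowest type is nonnegative, and likewise for the highest type.
  As \<open>T\<close> is connected these sets meet, which gives a type \<open>s\<close> and \<open>h m\<^sub>1\<close>, \<open>h m\<^sub>2\<close> that are nonnegative
  below and above \<open>s\<close>, respectively. If every mixture of the two were negative somewhere, then by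
  connectedness of the interval of weights some mixture would be negative both below and above \<open>s\<close>,
  while being nonnegative at \<open>s\<close>, contrary to single crossing.

  If a member \<open>b\<close> of a minimal optimal menu were dominated by \<open>a \<noteq> b\<close>, one could dominate every bundle
  in the support of \<open>a\<close> by a mixture of the menu, and so \<open>b\<close> itself by their average. At a type where
  \<open>b\<close> is the only maximizer in the menu this average must be \<open>b\<close>, so all bundles in the support of \<open>a\<close>
  lie below \<open>b\<close>, and hence coincide with \<open>b\<close> as functions of the type.\<close>

section \<open>Single-crossing functions and nonnegative mixtures\<close>

lemma single_crossing_on_nonneg_between:
  assumes "single_crossing_on T g" and "x \<in> T" "y \<in> T" "z \<in> T"
    and "x \<le> y" "y \<le> z" and "g x \<ge> 0" "g z \<ge> 0"
  shows "g y \<ge> 0"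
proof -
  \<comment> \<open>The cases are an increasing and a decreasing sign; either way the sign at
    \<open>y\<close> is bounded below by the sign at one of the outer points.\<close>
  from assms(1) consider "sgn (g x) \<le> sgn (g y)" | "sgn (g z) \<le> sgn (g y)"
    using assms(2-6) unfolding single_crossing_on_def monotone_on_def by blast
  then show ?thesis
    using assms(7,8) by cases (auto simp: sgn_if split: if_splits)
qed

lemma single_crossing_on_neg_between:
  assumes "single_crossing_on T g" and "x \<in> T" "y \<in> T" "z \<in> T"
    and "x \<le> y" "y \<le> z" and "g x < 0" "g z < 0"
  shows "g y < 0"
proof -
  from assms(1) consider "sgn (g y) \<le> sgn (g z)" | "sgn (g y) \<le> sgn (g x)"
    using assms(2-6) unfolding single_crossing_on_def monotone_on_def by blast
  then show ?thesis
    using assms(7,8) by cases (auto simp: sgn_if split: if_splits)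
qed

lemma exists_nonneg_convex_combination:
  fixes g h :: "real \<Rightarrow> real"
  assumes s: "s \<in> T"
    and g: "\<And>t. t \<in> T \<Longrightarrow> t \<le> s \<Longrightarrow> g t \<ge> 0"
    and h: "\<And>t. t \<in> T \<Longrightarrow> s \<le> t \<Longrightarrow> h t \<ge> 0"
    and sc: "\<And>p. p \<in> {0..1} \<Longrightarrow> single_crossing_on T (\<lambda>t. p * g t + (1 - p) * h t)"
  shows "\<exists>p\<in>{0..1}. \<forall>t\<in>T. p * g t + (1 - p) * h t \<ge> 0"
proof (rule ccontr)
  assume none: "\<not> ?thesis"
  let ?m = "\<lambda>p t. p * g t + (1 - p) * h t"
  \<comment> \<open>Weights whose mixture is negative somewhere at or below \<open>s\<close>,
    respectively at or above \<open>s\<close>. Both sets are open, as unions over types of strict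
    affine inequalities in the weight.\<close>
  define A where "A = (\<Union>t\<in>{t\<in>T. t \<le> s}. {p. ?m p t < 0})"
  define B where "B = (\<Union>t\<in>{t\<in>T. s \<le> t}. {p. ?m p t < 0})"
  have op: "open A" "open B"
    unfolding A_def B_def by (intro open_UN ballI open_Collect_less continuous_intros)+
  have cover: "{0..1} \<subseteq> A \<union> B"
  proof
    fix p :: real assume "p \<in> {0..1}"
    with none obtain t where "t \<in> T" "?m p t < 0" by (meson not_le)
    then show "p \<in> A \<union> B"
      unfolding A_def B_def by (cases "t \<le> s") auto
  qed
  \<comment> \<open>Weight 1 is \<open>g\<close> alone and weight 0 is \<open>h\<close> alone, so
    neither can fail on the side where its function is nonnegative.\<close>
  have "1 \<notin> A" "0 \<notin> B"
    using g h by (force simp: A_def B_def)+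
  moreover have "1 \<in> A \<union> B" "0 \<in> A \<union> B"
    by (rule subsetD[OF cover], simp)+
  ultimately have "1 \<in> B" "0 \<in> A" by auto
  then have "A \<inter> {0..1} \<noteq> {}" "B \<inter> {0..1} \<noteq> {}" by auto
  moreover have "A \<inter> B \<inter> {0..1} = {}"
  proof (rule ccontr)
    assume "A \<inter> B \<inter> {0..1} \<noteq> {}"
    then obtain p x y where p: "p \<in> {0..1}"
      and "x \<in> T" "x \<le> s" "?m p x < 0" "y \<in> T" "s \<le> y" "?m p y < 0"
      unfolding A_def B_def by blast
    then have "?m p s < 0"
      using single_crossing_on_neg_between[OF sc[OF p]] s by blast
    moreover have "?m p s \<ge> 0"
      using p g[OF s] h[OF s] by simp
    ultimately show False by simp
  qed
  ultimately show False
    using connected_Icc[of "0::real" 1] op cover unfolding connected_def by blast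
qed

lemma exists_nonneg_mixture:
  fixes h :: "'b \<Rightarrow> real \<Rightarrow> real"
  assumes le: "lo \<le> hi" and fin: "finite M"
    and cont: "\<And>m. m \<in> M \<Longrightarrow> continuous_on {lo..hi} (h m)"
    and sc: "\<And>a. set_pmf a \<subseteq> M \<Longrightarrow>
      single_crossing_on {lo..hi} (\<lambda>t. measure_pmf.expectation a (\<lambda>m. h m t))"
    and nonneg: "\<And>t. t \<in> {lo..hi} \<Longrightarrow> \<exists>m\<in>M. h m t \<ge> 0"
  shows "\<exists>a. set_pmf a \<subseteq> M \<and> (\<forall>t\<in>{lo..hi}. measure_pmf.expectation a (\<lambda>m. h m t) \<ge> 0)"
proof -
  have sc1: "single_crossing_on {lo..hi} (h m)" if "m \<in> M" for m
    using sc[of "return_pmf m"] that by simp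
  \<comment> \<open>\<open>U lo\<close> and \<open>U hi\<close> are the two closed sets that must
    meet; finiteness of \<open>M\<close> keeps the unions closed.\<close>
  define U where "U x = (\<Union>m\<in>{m\<in>M. h m x \<ge> 0}. {t\<in>{lo..hi}. 0 \<le> h m t})" for x
  have closed: "closed (U x)" for x
    unfolding U_def using fin cont
    by (intro closed_UN ballI continuous_on_closed_Collect_le) auto
  have "{lo..hi} \<subseteq> U lo \<union> U hi"
  proof
    fix t assume t: "t \<in> {lo..hi}"
    then obtain m where m: "m \<in> M" "h m t \<ge> 0" using nonneg by blast
    \<comment> \<open>A function negative at both end points would be negative at \<open>t\<close>
      too.\<close>
    then have "h m lo \<ge> 0 \<or> h m hi \<ge> 0"
      using single_crossing_on_neg_between[OF sc1[OF m(1)], of lo t hi] t le by force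
    with t m show "t \<in> U lo \<union> U hi" by (auto simp: U_def)
  qed
  moreover have "lo \<in> U lo \<inter> {lo..hi}" "hi \<in> U hi \<inter> {lo..hi}"
    using nonneg[of lo] nonneg[of hi] le by (auto simp: U_def)
  ultimately have "U lo \<inter> U hi \<inter> {lo..hi} \<noteq> {}"
    using connected_Icc[of lo hi] closed[of lo] closed[of hi] unfolding connected_closed by blast
  then obtain s m\<^sub>1 m\<^sub>2 where s: "s \<in> {lo..hi}"
    and m1: "m\<^sub>1 \<in> M" "h m\<^sub>1 lo \<ge> 0" "h m\<^sub>1 s \<ge> 0"
    and m2: "m\<^sub>2 \<in> M" "h m\<^sub>2 hi \<ge> 0" "h m\<^sub>2 s \<ge> 0"
    unfolding U_def by blast
  \<comment> \<open>\<open>bernoulli_pmf\<close> truncates its parameter to the unit interval, so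
    the support bound holds for every real \<open>p\<close>, whereas the formula for the expectation
    asks for \<open>p\<close> in that interval.\<close>
  define mix where "mix p = map_pmf (\<lambda>x. if x then m\<^sub>1 else m\<^sub>2) (bernoulli_pmf p)" for p
  have mix: "set_pmf (mix p) \<subseteq> M" for p
    using m1 m2 by (auto simp: mix_def)
  have exp: "measure_pmf.expectation (mix p) (\<lambda>m. h m t) = p * h m\<^sub>1 t + (1 - p) * h m\<^sub>2 t"
    if "p \<in> {0..1}" for p t
    using that by (simp add: mix_def)
  have "\<exists>p\<in>{0..1}. \<forall>t\<in>{lo..hi}. p * h m\<^sub>1 t + (1 - p) * h m\<^sub>2 t \<ge> 0"
  proof (rule exists_nonneg_convex_combination[OF s])
    show "h m\<^sub>1 t \<ge> 0" if "t \<in> {lo..hi}" "t \<le> s" for t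
      using single_crossing_on_nonneg_between[OF sc1[OF m1(1)], of lo t s] that m1 s by auto
    show "h m\<^sub>2 t \<ge> 0" if "t \<in> {lo..hi}" "s \<le> t" for t
      using single_crossing_on_nonneg_between[OF sc1[OF m2(1)], of s t hi] that m2 s by auto
    show "single_crossing_on {lo..hi} (\<lambda>t. p * h m\<^sub>1 t + (1 - p) * h m\<^sub>2 t)" if "p \<in> {0..1}" for p
      using sc[OF mix[of p]] exp[OF that] by simp
  qed
  then show ?thesis
    using mix exp by metis
qed

section \<open>Expectations attaining a bound, and continuity of virtual values\<close>

lemma pmf_expectation_ge_bound_imp_eq:
  fixes f :: "'b \<Rightarrow> real"
  assumes "finite (set_pmf a)" and "\<And>x. x \<in> set_pmf a \<Longrightarrow> f x \<le> k"
    and "measure_pmf.expectation a f \<ge> k" and "x \<in> set_pmf a"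
  shows "f x = k"
proof -
  have int: "integrable (measure_pmf a) g" for g :: "'b \<Rightarrow> real"
    using assms(1) by (rule integrable_measure_pmf_finite)
  have nonneg: "AE x in measure_pmf a. 0 \<le> k - f x"
    using assms(2) by (simp add: AE_measure_pmf_iff)
  \<comment> \<open>The gap \<open>k - f x\<close> is nonnegative on the support and has mean at
    most 0, so it vanishes at every support point.\<close>
  have "measure_pmf.expectation a (\<lambda>x. k - f x) = k - measure_pmf.expectation a f"
    using int by simp
  with assms(3) integral_nonneg_AE[OF nonneg] have "measure_pmf.expectation a (\<lambda>x. k - f x) = 0"
    by linarith
  then have "AE x in measure_pmf a. k - f x = 0"
    using integral_nonneg_eq_0_iff_AE[OF int nonneg] by simp
  with assms(4) show ?thesis by (simp add: AE_measure_pmf_iff)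
qed

lemma finite_bundles [simp]: "finite (bundles n)"
  by (simp add: bundles_def)

lemma virtual_value_expectation:
  "virtual_value T F f v a t =
     measure_pmf.expectation a (\<lambda>b. virtual_value T F f v (return_pmf b) t)"
  by (simp add: virtual_value_def)

text \<open>The delicate factor is the cdf: having a density, \<open>F\<close> has no atoms, so
  \<open>cdf F\<close> is continuous. Positivity of \<open>f\<close> takes care of the
  quotient.\<close>

lemma continuous_on_virtual_value_return:
  assumes T: "T = {t_lo..t_hi}"
    and f: "continuous_on T f" "\<And>t. t \<in> T \<Longrightarrow> f t > 0"
    and F: "F = density lborel (\<lambda>t. ennreal (indicator T t * f t))" "prob_space F"
    and v: "v (return_pmf b) differentiable_on T"
      "continuous_on T (\<lambda>t. vector_derivative (v (return_pmf b)) (at t within T))"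
  shows "continuous_on T (virtual_value T F f v (return_pmf b))"
proof -
  interpret prob_space F by fact
  interpret finite_borel_measure F
    by unfold_locales (simp add: F)
  have meas: "(\<lambda>t. ennreal (indicator T t * f t)) \<in> borel_measurable lborel"
    using borel_measurable_continuous_on_indicator[OF _ f(1)] T by simp
  have "emeasure F {x} = 0" for x
  proof -
    have "{x} \<in> null_sets lborel" by (simp add: null_sets_def)
    then show ?thesis
      unfolding F(1) using meas by (simp add: emeasure_density nn_integral_null_set)
  qed
  then have "isCont (cdf F) x" for x
    by (simp add: isCont_cdf measure_def)
  then have "continuous_on T (cdf F)"
    by (simp add: continuous_at_imp_continuous_on)
  moreover have "continuous_on T (v (return_pmf b))"
    using v(1) by (rule differentiable_imp_continuous_on)
  ultimately show ?thesis
    unfolding virtual_value_def using f v(2)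
    by (auto intro!: continuous_intros simp: less_imp_neq[symmetric])
qed

section \<open>Optimal menus under single crossing\<close>

locale single_crossing_bundles =
  fixes n :: nat and lo hi :: real and \<phi> :: "nat set pmf \<Rightarrow> real \<Rightarrow> real"
  assumes lo_le_hi: "lo \<le> hi"
    and expectation: "\<And>a t. \<phi> a t = measure_pmf.expectation a (\<lambda>b. \<phi> (return_pmf b) t)"
    and cont: "\<And>b. b \<in> bundles n \<Longrightarrow> continuous_on {lo..hi} (\<phi> (return_pmf b))"
    and distinct: "\<And>b b'. b \<in> bundles n \<Longrightarrow> b' \<in> bundles n \<Longrightarrow> b \<noteq> b' \<Longrightarrow>
      \<exists>t\<in>{lo..hi}. \<phi> (return_pmf b) t \<noteq> \<phi> (return_pmf b') t"
    and sc: "\<And>a a'. a \<in> stochastic_bundles n \<Longrightarrow> a' \<in> stochastic_bundles n \<Longrightarrow>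
      single_crossing_on {lo..hi} (\<lambda>t. \<phi> a t - \<phi> a' t)"
begin

abbreviation "T \<equiv> {lo..hi}"

lemma finite_set_pmf: "set_pmf a \<subseteq> bundles n \<Longrightarrow> finite (set_pmf a)"
  using finite_subset finite_bundles by blast

lemma optimal_menu_iff:
  "optimal_menu n T \<phi> M \<longleftrightarrow> M \<subseteq> bundles n \<and>
     (\<forall>t\<in>T. \<exists>m\<in>M. \<forall>b\<in>bundles n. \<phi> (return_pmf b) t \<le> \<phi> (return_pmf m) t)"
  unfolding optimal_menu_def is_arg_max_linorder by blast

text \<open>Follows from \<open>exists_nonneg_mixture\<close> for the differences
  \<open>?h m\<close>, as their mean under \<open>a\<close> is again a difference of virtual values.
  Members of \<open>M\<close> are included so that every bundle in the support of a lottery can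
  later be replaced at once.\<close>

lemma optimal_menu_dominates:
  assumes "optimal_menu n T \<phi> M" and b: "b \<in> bundles n"
  shows "\<exists>a. set_pmf a \<subseteq> M \<and> (\<forall>t\<in>T. \<phi> (return_pmf b) t \<le> \<phi> a t)"
proof -
  have M: "M \<subseteq> bundles n"
    and max: "\<And>t. t \<in> T \<Longrightarrow> \<exists>m\<in>M. \<phi> (return_pmf b) t \<le> \<phi> (return_pmf m) t"
    using assms unfolding optimal_menu_iff by blast+
  let ?h = "\<lambda>m t. \<phi> (return_pmf m) t - \<phi> (return_pmf b) t"
  have exp: "measure_pmf.expectation a (\<lambda>m. ?h m t) = \<phi> a t - \<phi> (return_pmf b) t"
    if "set_pmf a \<subseteq> M" for a t
  proof -
    have "integrable (measure_pmf a) (\<lambda>m. \<phi> (return_pmf m) t)"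
      using that M finite_set_pmf by (intro integrable_measure_pmf_finite) blast
    then show ?thesis
      by (simp add: expectation[of a])
  qed
  have "\<exists>a. set_pmf a \<subseteq> M \<and> (\<forall>t\<in>T. measure_pmf.expectation a (\<lambda>m. ?h m t) \<ge> 0)"
  proof (rule exists_nonneg_mixture[OF lo_le_hi])
    show "finite M" using M finite_bundles by (rule finite_subset)
    show "continuous_on T (?h m)" if "m \<in> M" for m
      using that M b cont by (auto intro!: continuous_on_diff)
    show "single_crossing_on T (\<lambda>t. measure_pmf.expectation a (\<lambda>m. ?h m t))"
      if "set_pmf a \<subseteq> M" for a
      unfolding exp[OF that] using that M b
      by (intro sc) (auto simp: stochastic_bundles_def)
    show "\<exists>m\<in>M. 0 \<le> ?h m t" if "t \<in> T" for t
      using max[OF that] by simp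
  qed
  then show ?thesis
    using exp by (metis diff_ge_0_iff_ge)
qed

lemma optimal_menu_very_weakly_dominates:
  assumes "optimal_menu n T \<phi> M" and "b \<in> bundles n - M"
  shows "\<exists>a\<in>convex_combinations M. very_weakly_dominated_by T \<phi> (return_pmf b) a"
proof -
  obtain a where "set_pmf a \<subseteq> M" "\<forall>t\<in>T. \<phi> (return_pmf b) t \<le> \<phi> a t"
    using optimal_menu_dominates assms by blast
  moreover from this have "a \<noteq> return_pmf b"
    using assms by auto
  ultimately show ?thesis
    unfolding convex_combinations_def very_weakly_dominated_by_def by blast
qed

lemma minimal_optimal_menu_not_very_weakly_dominated:
  assumes "minimal_optimal_menu n T \<phi> M" and b: "b \<in> M"
  shows "\<not> very_weakly_dominated n T \<phi> (return_pmf b)"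
proof
  assume "very_weakly_dominated n T \<phi> (return_pmf b)"
  then obtain a where a: "set_pmf a \<subseteq> bundles n" "a \<noteq> return_pmf b"
    and dom: "\<And>t. t \<in> T \<Longrightarrow> \<phi> (return_pmf b) t \<le> \<phi> a t"
    unfolding very_weakly_dominated_def very_weakly_dominated_by_def stochastic_bundles_def by blast
  have opt: "optimal_menu n T \<phi> M" and notopt: "\<not> optimal_menu n T \<phi> (M - {b})"
    using assms by (auto simp: minimal_optimal_menu_def)
  then have M: "M \<subseteq> bundles n" by (simp add: optimal_menu_iff)
  \<comment> \<open>Removing \<open>b\<close> destroys optimality at some type; there
    \<open>b\<close> is a maximizer and no other member of \<open>M\<close> ties with it.\<close>
  obtain t where t: "t \<in> T"
    and strict: "\<And>m. m \<in> M \<Longrightarrow> m \<noteq> b \<Longrightarrow> \<phi> (return_pmf m) t < \<phi> (return_pmf b) t"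
  proof -
    obtain t where t: "t \<in> T"
      and no: "\<not> (\<exists>m\<in>M - {b}. \<forall>b'\<in>bundles n. \<phi> (return_pmf b') t \<le> \<phi> (return_pmf m) t)"
      using notopt M unfolding optimal_menu_iff by blast
    moreover obtain m where "m \<in> M" "\<forall>b'\<in>bundles n. \<phi> (return_pmf b') t \<le> \<phi> (return_pmf m) t"
      using opt t unfolding optimal_menu_iff by blast
    ultimately have "\<forall>b'\<in>bundles n. \<phi> (return_pmf b') t \<le> \<phi> (return_pmf b) t"
      by (cases "m = b") auto
    then have "\<phi> (return_pmf m) t < \<phi> (return_pmf b) t" if "m \<in> M" "m \<noteq> b" for m
      using no that by (meson Diff_iff empty_iff insert_iff not_le order_trans)
    with t show thesis by (rule that)
  qed
  obtain c where c: "\<And>b'. b' \<in> bundles n \<Longrightarrow> set_pmf (c b') \<subseteq> M"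
    and c_ge: "\<And>b' t. b' \<in> bundles n \<Longrightarrow> t \<in> T \<Longrightarrow> \<phi> (return_pmf b') t \<le> \<phi> (c b') t"
    using optimal_menu_dominates[OF opt] by metis
  let ?\<phi>t = "\<lambda>x. \<phi> (return_pmf x) t"
  have le_b: "?\<phi>t m \<le> ?\<phi>t b" if "m \<in> M" for m
    using strict that by (cases "m = b") (auto simp: less_imp_le)
  have c_le: "\<phi> (c b') t \<le> ?\<phi>t b" if "b' \<in> bundles n" for b'
  proof -
    have "measure_pmf.expectation (c b') ?\<phi>t \<le> measure_pmf.expectation (c b') (\<lambda>_. ?\<phi>t b)"
      using that c[OF that] M le_b finite_set_pmf
      by (intro integral_mono_AE integrable_measure_pmf_finite)
        (auto simp: AE_measure_pmf_iff)
    then show ?thesis by (simp add: expectation[of "c b'"])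
  qed
  have below: "\<phi> (return_pmf b') x \<le> \<phi> (return_pmf b) x" if b': "b' \<in> set_pmf a" and x: "x \<in> T" for b' x
  proof -
    \<comment> \<open>Each support point is worth at most its replacement \<open>c y\<close>, hence
      at most \<open>b\<close>, while the mean over \<open>a\<close> is at least the value of
      \<open>b\<close>.\<close>
    have "?\<phi>t y = ?\<phi>t b" if "y \<in> set_pmf a" for y
    proof (rule pmf_expectation_ge_bound_imp_eq[OF finite_set_pmf[OF a(1)] _ _ that])
      show "?\<phi>t y \<le> ?\<phi>t b" if "y \<in> set_pmf a" for y
        using c_ge c_le a(1) t that by (meson order_trans subsetD)
      show "?\<phi>t b \<le> measure_pmf.expectation a ?\<phi>t"
        using dom[OF t] by (simp add: expectation[of a])
    qed
    \<comment> \<open>So \<open>c b'\<close> also attains the value of \<open>b\<close> at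
      \<open>t\<close>; since \<open>b\<close> is the strict maximizer in \<open>M\<close>, this
      lottery is the point mass at \<open>b\<close>.\<close>
    then have ge: "?\<phi>t b \<le> measure_pmf.expectation (c b') ?\<phi>t"
      using c_ge[of b' t] a(1) b' t by (auto simp: expectation[of "c b'"])
    have "?\<phi>t m = ?\<phi>t b" if "m \<in> set_pmf (c b')" for m
      using pmf_expectation_ge_bound_imp_eq[OF _ _ ge that] finite_set_pmf c a(1) b' M le_b
      by (meson subset_trans subsetD)
    then have "set_pmf (c b') \<subseteq> {b}"
      using strict c a(1) b' by (metis less_irrefl singletonI subsetD subsetI)
    then have "c b' = return_pmf b"
      by (simp add: set_pmf_subset_singleton)
    then show ?thesis
      using c_ge[of b' x] a(1) b' x by auto
  qed
  obtain b' where b': "b' \<in> set_pmf a" "b' \<noteq> b"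
    using a(2) by (metis set_pmf_subset_singleton singletonI subsetI)
  then obtain x where x: "x \<in> T" "\<phi> (return_pmf b') x \<noteq> \<phi> (return_pmf b) x"
    using distinct[of b' b] a(1) b M by blast
  \<comment> \<open>No support point exceeds \<open>b\<close> at \<open>x\<close>, yet their mean is
    at least the value of \<open>b\<close>.\<close>
  have "\<phi> (return_pmf b') x = \<phi> (return_pmf b) x"
    using pmf_expectation_ge_bound_imp_eq[OF finite_set_pmf[OF a(1)], of "\<lambda>y. \<phi> (return_pmf y) x"]
      below x(1) dom[OF x(1)] b'(1) by (simp add: expectation[of a])
  with x(2) show False by contradiction
qed

text \<open>If a maximizer \<open>k\<close> is omitted, a lottery over \<open>M\<close> worth at
  least as much can only be supported on maximizers.\<close>

lemma dominating_menu_optimal: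
  assumes M: "M \<subseteq> bundles n"
    and dom: "\<And>b. b \<in> bundles n - M \<Longrightarrow>
      \<exists>a\<in>convex_combinations M. very_weakly_dominated_by T \<phi> (return_pmf b) a"
  shows "optimal_menu n T \<phi> M"
  unfolding optimal_menu_iff
proof (intro conjI ballI M)
  fix t assume t: "t \<in> T"
  let ?\<phi>t = "\<lambda>x. \<phi> (return_pmf x) t"
  have "bundles n \<noteq> {}" by (auto simp: bundles_def)
  then obtain k where k: "k \<in> bundles n" "\<And>b. b \<in> bundles n \<Longrightarrow> ?\<phi>t b \<le> ?\<phi>t k"
    using ex_is_arg_min_if_finite[OF finite_bundles, of n "\<lambda>b. - ?\<phi>t b"]
    by (auto simp: is_arg_min_linorder)
  show "\<exists>m\<in>M. \<forall>b\<in>bundles n. ?\<phi>t b \<le> ?\<phi>t m"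
  proof (cases "k \<in> M")
    case True
    with k show ?thesis by blast
  next
    case False
    then obtain a where a: "set_pmf a \<subseteq> M" and "?\<phi>t k \<le> \<phi> a t"
      using dom[of k] k(1) t unfolding convex_combinations_def very_weakly_dominated_by_def by blast
    then have ge: "?\<phi>t k \<le> measure_pmf.expectation a ?\<phi>t"
      by (simp add: expectation[of a])
    obtain m where m: "m \<in> set_pmf a" using set_pmf_not_empty[of a] by blast
    have "?\<phi>t m = ?\<phi>t k"
      using pmf_expectation_ge_bound_imp_eq[OF _ _ ge m] finite_set_pmf a M k(2)
      by (meson subset_trans subsetD)
    then show ?thesis
      using m a k(2) by (intro bexI[of _ m]) auto
  qed
qed

text \<open>Used in contrapositive form: undominated bundles belong to every optimal menu, which
  gives both minimality and uniqueness.\<close>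

lemma bundle_outside_optimal_menu_dominated:
  assumes "optimal_menu n T \<phi> M" and b: "b \<in> bundles n - M"
  shows "very_weakly_dominated n T \<phi> (return_pmf b)"
proof -
  have "M \<subseteq> bundles n" using assms by (simp add: optimal_menu_iff)
  then show ?thesis
    using optimal_menu_very_weakly_dominates[OF assms]
    unfolding very_weakly_dominated_def convex_combinations_def stochastic_bundles_def by blast
qed

lemma minimal_optimal_menu_iff:
  assumes M: "M \<subseteq> bundles n"
  shows "minimal_optimal_menu n T \<phi> M \<longleftrightarrow>
    ((\<forall>b\<in>bundles n. very_weakly_dominated n T \<phi> (return_pmf b) \<longrightarrow>
        (\<exists>a\<in>convex_combinations M. very_weakly_dominated_by T \<phi> (return_pmf b) a)) \<and>
     (\<forall>b\<in>bundles n - M.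
        \<exists>a\<in>convex_combinations M. very_weakly_dominated_by T \<phi> (return_pmf b) a)) \<and>
    (\<forall>b\<in>M. \<not> very_weakly_dominated n T \<phi> (return_pmf b))" (is "_ \<longleftrightarrow> ?C")
proof
  assume min: "minimal_optimal_menu n T \<phi> M"
  then have "optimal_menu n T \<phi> M" by (simp add: minimal_optimal_menu_def)
  \<comment> \<open>A dominated bundle cannot be a member of \<open>M\<close>, so the first clause
    reduces to bundles outside \<open>M\<close>.\<close>
  then show ?C
    using optimal_menu_very_weakly_dominates minimal_optimal_menu_not_very_weakly_dominated[OF min]
    by blast
next
  assume C: ?C
  then have "optimal_menu n T \<phi> M"
    using dominating_menu_optimal[OF M] by blast
  moreover have "\<not> optimal_menu n T \<phi> M'" if "M' \<subset> M" for M'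
    using bundle_outside_optimal_menu_dominated C that M by blast
  ultimately show "minimal_optimal_menu n T \<phi> M"
    by (simp add: minimal_optimal_menu_def)
qed

lemma ex1_minimal_optimal_menu: "\<exists>!M. minimal_optimal_menu n T \<phi> M"
proof (rule ex_ex1I)
  \<comment> \<open>Vacuously, since this menu omits no bundle.\<close>
  have "optimal_menu n T \<phi> (bundles n)"
    by (rule dominating_menu_optimal) auto
  then obtain M where "optimal_menu n T \<phi> M"
    "\<And>M'. optimal_menu n T \<phi> M' \<Longrightarrow> M' \<subseteq> M \<Longrightarrow> M = M'"
    using finite_has_minimal2[of "{M. optimal_menu n T \<phi> M}" "bundles n"]
    by (auto simp: optimal_menu_iff intro: finite_subset[of _ "Pow (bundles n)"])
  then show "\<exists>M. minimal_optimal_menu n T \<phi> M"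
    unfolding minimal_optimal_menu_def by blast
next
  have sub: "M \<subseteq> M'" if "minimal_optimal_menu n T \<phi> M" "minimal_optimal_menu n T \<phi> M'" for M M'
  proof
    fix b assume b: "b \<in> M"
    have "optimal_menu n T \<phi> M" "optimal_menu n T \<phi> M'"
      using that by (simp_all add: minimal_optimal_menu_def)
    then show "b \<in> M'"
      using bundle_outside_optimal_menu_dominated minimal_optimal_menu_not_very_weakly_dominated[OF that(1) b] b
      unfolding optimal_menu_iff by blast
  qed
  show "M = M'" if "minimal_optimal_menu n T \<phi> M" "minimal_optimal_menu n T \<phi> M'" for M M'
    using sub that by blast
qed

end

theorem proposition2:
  fixes n :: nat and t_lo t_hi :: real and T :: "real set"
    and F :: "real measure" and f :: "real \<Rightarrow> real"
    and v \<phi> :: "nat set pmf \<Rightarrow> real \<Rightarrow> real"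
  assumes "n \<ge> 1"
    and "t_lo < t_hi" and "T = {t_lo..t_hi}"
    and "continuous_on T f" and "\<And>t. t \<in> T \<Longrightarrow> f t > 0"
    and "F = density lborel (\<lambda>t. ennreal (indicator T t * f t))" and "prob_space F"
    and "\<And>a. a \<in> stochastic_bundles n \<Longrightarrow> v a differentiable_on T"
    and "\<And>a. a \<in> stochastic_bundles n \<Longrightarrow>
           continuous_on T (\<lambda>t. vector_derivative (v a) (at t within T))"
    and "\<And>t. t \<in> T \<Longrightarrow> v (return_pmf {}) t = 0"
    and "\<And>a t. a \<in> stochastic_bundles n \<Longrightarrow> t \<in> T \<Longrightarrow>
           v a t = measure_pmf.expectation a (\<lambda>b. v (return_pmf b) t)"
    and "\<phi> = virtual_value T F f v"
    and "\<And>b b'. b \<in> bundles n \<Longrightarrow> b' \<in> bundles n \<Longrightarrow> b \<noteq> b' \<Longrightarrow>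
           \<exists>t\<in>T. \<phi> (return_pmf b) t \<noteq> \<phi> (return_pmf b') t"
    and "(MAX b\<in>bundles n - {{}}. \<phi> (return_pmf b) t_lo) < 0"
    and "\<phi> (return_pmf {}) t_lo = 0"
    and "\<And>a a'. a \<in> stochastic_bundles n \<Longrightarrow> a' \<in> stochastic_bundles n \<Longrightarrow>
           single_crossing_on T (\<lambda>t. \<phi> a t - \<phi> a' t)"
  shows "(\<forall>M. M \<subseteq> bundles n \<longrightarrow>
            (minimal_optimal_menu n T \<phi> M \<longleftrightarrow>
               ((\<forall>b\<in>bundles n. very_weakly_dominated n T \<phi> (return_pmf b) \<longrightarrow>
                   (\<exists>a\<in>convex_combinations M. very_weakly_dominated_by T \<phi> (return_pmf b) a)) \<and>
                (\<forall>b\<in>bundles n - M.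
                   \<exists>a\<in>convex_combinations M. very_weakly_dominated_by T \<phi> (return_pmf b) a)) \<and>
               (\<forall>b\<in>M. \<not> very_weakly_dominated n T \<phi> (return_pmf b))))
         \<and> (\<exists>!M. minimal_optimal_menu n T \<phi> M)"
proof -
  interpret single_crossing_bundles n t_lo t_hi \<phi>
  proof
    show "t_lo \<le> t_hi" using assms(2) by simp
    show "\<phi> a t = measure_pmf.expectation a (\<lambda>b. \<phi> (return_pmf b) t)" for a t
      unfolding assms(12) by (rule virtual_value_expectation)
    show "continuous_on {t_lo..t_hi} (\<phi> (return_pmf b))" if "b \<in> bundles n" for b
    proof -
      have "return_pmf b \<in> stochastic_bundles n"
        using that by (simp add: stochastic_bundles_def)
      then show ?thesis
        using continuous_on_virtual_value_return[OF assms(3-7)] assms(8,9) assms(3,12) by simp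
    qed
  qed (use assms(3,13,16) in auto)
  show ?thesis
    unfolding assms(3) using minimal_optimal_menu_iff ex1_minimal_optimal_menu by simp
qed

end
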